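(* Let $f:X\to Y$ be a function from a Preiss-Simon topological space $X$ to a regular topological space $Y$. Then the following conditions are equivalent: (1) $f$ is weakly discontinuous; (2) $f$ is resolvable; (3) $f$ is open-resolvable; (4) $f$ is base-resolvable.
   Context: Functions are not assumed continuous. A topological space $X$ is Preiss-Simon at a point $x\in X$ if for every subset $A\subset X$ with $x\in\overline{A}$ there is a sequence $(U_n)_{n\in\omega}$ of non-empty open subsets of (the subspace) $A$ that converges to $x$, in the sense that each neighborhood of $x$ contains all but finitely many of the sets $U_n$. The space $X$ is Preiss-Simon if it is Preiss-Simon at each of its points. A function $f:X\to Y$ between topological spaces is weakly discontinuous if every subspace $A\subset X$ contains a subset $U\subset A$ that is open and dense in $A$ and such that the restriction $f|U$ is continuous. A subset $A$ of a topological space $X$ is resolvable if for every closed subset $F\subset X$ the set $\overline{F\cap A}\cap\overline{F\setminus A}$ is nowhere dense in $F$. A function $f:X\to Y$ is resolvable (respectively, open-resolvable) if for every resolvable (respectively, open) subset $R\subset Y$ the preimage $f^{-1}(R)$ is a resolvable subset of $X$. A base $\mathcal B$ of the topology of a space is countably additive if the union $\bigcup\mathcal C$ of any countable subfamily $\mathcal C\subset\mathcal B$ belongs to $\mathcal B$. A function $f:X\to Y$ is base-resolvable if there exists a countably additive base $\mathcal B$ of the topology of $Y$ such that for every $B\in\mathcal B$ the preimage $f^{-1}(B)$ is a resolvable subset of $X$. *)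

theory Defs
  imports "HOL-Analysis.Analysis"
begin

definition nowhere_dense_in :: "'a topology \<Rightarrow> 'a set \<Rightarrow> bool" where
  "nowhere_dense_in X S \<longleftrightarrow>
     S \<subseteq> topspace X \<and> X interior_of (X closure_of S) = {}"

definition dense_in :: "'a topology \<Rightarrow> 'a set \<Rightarrow> bool" where
  "dense_in X S \<longleftrightarrow> S \<subseteq> topspace X \<and> X closure_of S = topspace X"

definition topology_base :: "'a topology \<Rightarrow> 'a set set \<Rightarrow> bool" where
  "topology_base X \<B> \<longleftrightarrow>
     (\<forall>B\<in>\<B>. openin X B) \<and> (\<forall>U. openin X U \<longrightarrow> (\<exists>\<C>. \<C> \<subseteq> \<B> \<and> U = \<Union>\<C>))"

definition Preiss_Simon_at :: "'a topology \<Rightarrow> 'a \<Rightarrow> bool" where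
  "Preiss_Simon_at X x \<longleftrightarrow>
     (\<forall>A. A \<subseteq> topspace X \<and> x \<in> X closure_of A \<longrightarrow>
       (\<exists>U :: nat \<Rightarrow> 'a set.
          (\<forall>n. openin (subtopology X A) (U n) \<and> U n \<noteq> {}) \<and>
          (\<forall>V. openin X V \<and> x \<in> V \<longrightarrow> (\<forall>\<^sub>F n in sequentially. U n \<subseteq> V))))"

definition Preiss_Simon_space :: "'a topology \<Rightarrow> bool" where
  "Preiss_Simon_space X \<longleftrightarrow> (\<forall>x\<in>topspace X. Preiss_Simon_at X x)"

definition weakly_discontinuous_map ::
    "'a topology \<Rightarrow> 'b topology \<Rightarrow> ('a \<Rightarrow> 'b) \<Rightarrow> bool" where
  "weakly_discontinuous_map X Y f \<longleftrightarrow>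
     (\<forall>A. A \<subseteq> topspace X \<longrightarrow>
       (\<exists>U. openin (subtopology X A) U \<and> dense_in (subtopology X A) U \<and>
            continuous_map (subtopology X U) Y f))"

definition resolvable_in :: "'a topology \<Rightarrow> 'a set \<Rightarrow> bool" where
  "resolvable_in X A \<longleftrightarrow>
     A \<subseteq> topspace X \<and>
     (\<forall>F. closedin X F \<longrightarrow>
        nowhere_dense_in (subtopology X F)
          ((X closure_of (F \<inter> A)) \<inter> (X closure_of (F - A))))"

definition resolvable_map ::
    "'a topology \<Rightarrow> 'b topology \<Rightarrow> ('a \<Rightarrow> 'b) \<Rightarrow> bool" where
  "resolvable_map X Y f \<longleftrightarrow>
     (\<forall>R. resolvable_in Y R \<longrightarrow> resolvable_in X {x \<in> topspace X. f x \<in> R})"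

definition open_resolvable_map ::
    "'a topology \<Rightarrow> 'b topology \<Rightarrow> ('a \<Rightarrow> 'b) \<Rightarrow> bool" where
  "open_resolvable_map X Y f \<longleftrightarrow>
     (\<forall>R. openin Y R \<longrightarrow> resolvable_in X {x \<in> topspace X. f x \<in> R})"

definition countably_additive :: "'a set set \<Rightarrow> bool" where
  "countably_additive \<B> \<longleftrightarrow> (\<forall>\<C>. \<C> \<subseteq> \<B> \<and> countable \<C> \<longrightarrow> \<Union>\<C> \<in> \<B>)"

definition base_resolvable_map ::
    "'a topology \<Rightarrow> 'b topology \<Rightarrow> ('a \<Rightarrow> 'b) \<Rightarrow> bool" where
  "base_resolvable_map X Y f \<longleftrightarrow>
     (\<exists>\<B>. topology_base Y \<B> \<and> countably_additive \<B> \<and>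
        (\<forall>B\<in>\<B>. resolvable_in X {x \<in> topspace X. f x \<in> B}))"

end

theory Submission
  imports Defs
begin

text \<open>
  Weak discontinuity implies resolvability for any $Y$: on a subset \<open>S\<close> of $X$ choose a nonempty
  open piece \<open>U\<close> on which $f$ is continuous; a resolvable set splits off a nonempty open part of
  \<open>f ` U\<close> lying on one side of it, and the continuity of $f$ on \<open>U\<close> pulls that part back. Open sets
  are resolvable and form a countably additive base, so the two further implications are immediate,
  and the weight of the proof lies in \<open>base_resolvable_imp_weakly_discontinuous\<close>.

  There, all the notions pass to subspaces, so it is enough to find one nonempty open set of
  continuity in a nonempty $X$. Call a point \<open>x\<close> escaping if \<open>f x\<close> has an open neighbourhood
  \<open>P\<close> such that open sets mapped off \<open>P\<close> accumulate at \<open>x\<close>. Since \<open>Y\<close> is regular, $f$ is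
  continuous on every open set without escaping points (\<open>continuous_if_no_escaping\<close>). So suppose
  that escaping points are dense. The proof then builds a sequence of points \<open>x\<^sub>0, x\<^sub>1, \<dots>\<close> and basic
  neighbourhoods \<open>B\<^sub>j\<close> of \<open>f x\<^sub>j\<close> such that \<open>f x\<^sub>i \<notin> B\<^sub>j\<close> for \<open>i \<noteq> j\<close>, while every \<open>x\<^sub>i\<close> is a limit both
  of points of even index and of points of odd index. The union of the \<open>B\<^sub>j\<close> with even \<open>j\<close> belongs
  to the base, but its preimage and the complement of that preimage are both dense in the set of
  all \<open>x\<^sub>j\<close>, which contradicts resolvability (\<open>escaping_not_dense\<close>).

  The Preiss-Simon property serves to reach \<open>x\<^sub>i\<close> with countably many later points. When \<open>x\<^sub>i\<close> is
  chosen, a sequence of open sets converging to it is fixed, and later points are picked inside these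
  sets. For this to remain possible, infinitely many of the sets must keep an open part that \<open>f\<close> maps
  off all neighbourhoods used so far. A new neighbourhood might spoil this for an earlier \<open>x\<^sub>i\<close>, or
  contain \<open>f x\<^sub>i\<close>; but among pairwise disjoint neighbourhoods at most one can do the former, by
  resolvability, and at most one the latter. With $N$ points already present, one of $2N+1$ candidates
  with disjoint neighbourhoods is therefore harmless (\<open>admissible_extend\<close>).
\<close>

section \<open>Local forms of the notions\<close>

lemma open_meets_if_meets_closure:
  "x \<in> X closure_of S \<Longrightarrow> openin X V \<Longrightarrow> x \<in> V \<Longrightarrow> V \<inter> S \<noteq> {}"
  by (auto simp: in_closure_of)

text \<open>
  A homogeneous open part is required of all subsets \<open>S\<close>, not just closed ones: \<open>S\<close> meets
  every open set that meets its closure. Conversely, if the common boundary of \<open>A\<close> and its complement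
  in \<open>F\<close> had interior \<open>W\<close> in \<open>F\<close>, then both would be dense in \<open>W\<close>, which would have no homogeneous
  part. In this form resolvability passes to subspaces and can be applied to countable sets.
\<close>

lemma resolvable_in_iff:
  "resolvable_in X A \<longleftrightarrow> A \<subseteq> topspace X \<and>
     (\<forall>S. S \<subseteq> topspace X \<and> S \<noteq> {} \<longrightarrow>
        (\<exists>V. openin X V \<and> V \<inter> S \<noteq> {} \<and> (V \<inter> S \<subseteq> A \<or> V \<inter> S \<inter> A = {})))"
    (is "_ \<longleftrightarrow> _ \<and> ?local")
proof (cases "A \<subseteq> topspace X")
  case False
  then show ?thesis by (simp add: resolvable_in_def)
next
  case A: True
  define T where "T F = (X closure_of (F \<inter> A)) \<inter> (X closure_of (F - A))" for F
  have T_in: "closedin X (T F)" "T F \<subseteq> F" if "closedin X F" for F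
    using that closure_of_minimal[of "F \<inter> A" F X]
    by (auto simp: T_def)
  have closure_T: "(subtopology X F) closure_of (T F) = T F" if "closedin X F" for F
    using T_in[OF that] by (simp add: closedin_subset_topspace closure_of_closedin)
  have "?local" if res: "\<forall>F. closedin X F \<longrightarrow> nowhere_dense_in (subtopology X F) (T F)"
  proof (intro allI impI)
    fix S assume S: "S \<subseteq> topspace X \<and> S \<noteq> {}"
    define F where "F = X closure_of S"
    have F: "closedin X F" "S \<subseteq> F" using S by (auto simp: F_def closure_of_subset)
    have "T F \<noteq> F"
    proof
      assume "T F = F"
      moreover have "(subtopology X F) interior_of (T F) = {}"
        using res[rule_format, OF F(1)] closure_T[OF F(1)] by (simp add: nowhere_dense_in_def)
      moreover have "(subtopology X F) interior_of F = F"
        using interior_of_topspace[of "subtopology X F"] closedin_subset[OF F(1)]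
        by (simp add: Int_absorb1)
      ultimately show False using S F by auto
    qed
    then obtain y where y: "y \<in> F" "y \<notin> T F" using T_in[OF F(1)] by blast
    consider "y \<notin> X closure_of (F \<inter> A)" | "y \<notin> X closure_of (F - A)"
      using y by (auto simp: T_def)
    then obtain E where E: "E = F \<inter> A \<or> E = F - A" "y \<notin> X closure_of E" by metis
    define V where "V = topspace X - X closure_of E"
    have V: "openin X V" "y \<in> V" using E y closedin_subset[OF F(1)] by (auto simp: V_def)
    have "V \<inter> S \<noteq> {}" using V y open_meets_if_meets_closure unfolding F_def by metis
    moreover have "V \<inter> E = {}" using E closure_of_subset[of E X] closedin_subset[OF F(1)]
      by (auto simp: V_def)
    ultimately show "\<exists>V. openin X V \<and> V \<inter> S \<noteq> {} \<and> (V \<inter> S \<subseteq> A \<or> V \<inter> S \<inter> A = {})"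
      using E F V by blast
  qed
  moreover have "nowhere_dense_in (subtopology X F) (T F)" if loc: ?local and F: "closedin X F" for F
  proof -
    define W where "W = (subtopology X F) interior_of (T F)"
    have W: "W \<subseteq> T F" "openin (subtopology X F) W"
      by (auto simp: W_def interior_of_subset)
    then obtain O' where O': "openin X O'" "W = O' \<inter> F" by (auto simp: openin_subtopology)
    have "W = {}"
    proof (rule ccontr)
      assume "W \<noteq> {}"
      moreover have "W \<subseteq> topspace X" using O' openin_subset by blast
      ultimately obtain V where V: "openin X V" "V \<inter> W \<noteq> {}"
          "V \<inter> W \<subseteq> A \<or> V \<inter> W \<inter> A = {}"
        using loc by meson
      then obtain z where z: "z \<in> V" "z \<in> O'" "z \<in> T F" using O' W by blast
      have O: "openin X (V \<inter> O')" using V O' by blast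
      have "z \<in> X closure_of (F \<inter> A)" "z \<in> X closure_of (F - A)" "z \<in> V \<inter> O'"
        using z by (simp_all add: T_def)
      then have "(V \<inter> O') \<inter> (F \<inter> A) \<noteq> {}" "(V \<inter> O') \<inter> (F - A) \<noteq> {}"
        using open_meets_if_meets_closure O by metis+
      then show False using V O' by blast
    qed
    then show ?thesis using T_in[OF F] closure_T[OF F] closedin_subset[OF F]
      by (auto simp: nowhere_dense_in_def W_def)
  qed
  ultimately show ?thesis using A by (auto simp: resolvable_in_def T_def)
qed

lemma resolvable_in_homogeneous_part:
  assumes "resolvable_in X A" "S \<subseteq> topspace X" "S \<noteq> {}"
  obtains V where "openin X V" "V \<inter> S \<noteq> {}" "V \<inter> S \<subseteq> A \<or> V \<inter> S \<inter> A = {}"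
proof -
  have "\<exists>V. openin X V \<and> V \<inter> S \<noteq> {} \<and> (V \<inter> S \<subseteq> A \<or> V \<inter> S \<inter> A = {})"
    using assms(1)[unfolded resolvable_in_iff] assms(2,3) by simp
  then show thesis using that by blast
qed

lemma open_imp_resolvable_in: "openin X R \<Longrightarrow> resolvable_in X R"
  unfolding resolvable_in_iff
proof (intro conjI allI impI)
  fix S assume R: "openin X R" and S: "S \<subseteq> topspace X \<and> S \<noteq> {}"
  show "\<exists>V. openin X V \<and> V \<inter> S \<noteq> {} \<and> (V \<inter> S \<subseteq> R \<or> V \<inter> S \<inter> R = {})"
  proof (cases "R \<inter> S = {}")
    case True
    then show ?thesis using S by (intro exI[of _ "topspace X"]) auto
  next
    case False
    then show ?thesis using R by blast
  qed
qed (use openin_subset in auto)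

lemma resolvable_in_subspace:
  assumes "resolvable_in X R"
  shows "resolvable_in (subtopology X A) (R \<inter> A)"
  unfolding resolvable_in_iff
proof (intro conjI allI impI)
  show "R \<inter> A \<subseteq> topspace (subtopology X A)" using assms by (auto simp: resolvable_in_def)
  fix S assume S: "S \<subseteq> topspace (subtopology X A) \<and> S \<noteq> {}"
  then have "S \<subseteq> topspace X" "S \<noteq> {}" by auto
  then obtain V where V: "openin X V" "V \<inter> S \<noteq> {}" "V \<inter> S \<subseteq> R \<or> V \<inter> S \<inter> R = {}"
    using resolvable_in_homogeneous_part[OF assms] by metis
  then show "\<exists>V. openin (subtopology X A) V \<and> V \<inter> S \<noteq> {} \<and>
               (V \<inter> S \<subseteq> R \<inter> A \<or> V \<inter> S \<inter> (R \<inter> A) = {})"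
    using S by (intro exI[of _ "V \<inter> A"]) (auto simp: openin_subtopology)
qed

lemma Preiss_Simon_sequence:
  fixes X :: "'a topology"
  assumes "Preiss_Simon_space X" "D \<subseteq> topspace X" "x \<in> X closure_of D"
  obtains U :: "nat \<Rightarrow> 'a set"
  where "\<And>n. openin (subtopology X D) (U n)" "\<And>n. U n \<noteq> {}"
    "\<And>V. openin X V \<Longrightarrow> x \<in> V \<Longrightarrow> \<forall>\<^sub>F n in sequentially. U n \<subseteq> V"
proof -
  have "x \<in> topspace X" using assms(3) by (simp add: in_closure_of)
  then have "Preiss_Simon_at X x" using assms(1) by (simp add: Preiss_Simon_space_def)
  from this[unfolded Preiss_Simon_at_def, rule_format, OF conjI[OF assms(2,3)]]
  obtain U :: "nat \<Rightarrow> 'a set" where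
    U: "\<forall>n. openin (subtopology X D) (U n) \<and> U n \<noteq> {}"
      "\<forall>V. openin X V \<and> x \<in> V \<longrightarrow> (\<forall>\<^sub>F n in sequentially. U n \<subseteq> V)"
    by (elim exE conjE)
  show thesis by (rule that[of U]) (use U in simp_all)
qed

lemma Preiss_Simon_subspace:
  fixes X :: "'a topology"
  assumes "Preiss_Simon_space X"
  shows "Preiss_Simon_space (subtopology X A)"
  unfolding Preiss_Simon_space_def Preiss_Simon_at_def
proof (intro ballI allI impI)
  fix x :: 'a and D
  assume x: "x \<in> topspace (subtopology X A)"
    and D: "D \<subseteq> topspace (subtopology X A) \<and> x \<in> subtopology X A closure_of D"
  have DA: "A \<inter> D = D" using D by auto
  then have "D \<subseteq> topspace X" "x \<in> X closure_of D"
    using D by (auto simp: closure_of_subtopology)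
  then obtain U :: "nat \<Rightarrow> 'a set"
    where U: "\<And>n. openin (subtopology X D) (U n)" "\<And>n. U n \<noteq> {}"
      "\<And>V. openin X V \<Longrightarrow> x \<in> V \<Longrightarrow> \<forall>\<^sub>F n in sequentially. U n \<subseteq> V"
    using Preiss_Simon_sequence[OF assms] by metis
  have "\<forall>\<^sub>F n in sequentially. U n \<subseteq> V" if V: "openin (subtopology X A) V" "x \<in> V" for V
  proof -
    obtain V' where V': "openin X V'" "V = V' \<inter> A" using V by (auto simp: openin_subtopology)
    have "U n \<subseteq> A" for n using U(1)[of n] openin_subset DA by fastforce
    then show ?thesis using U(3)[of V'] V' V by (auto elim: eventually_mono)
  qed
  then show "\<exists>U :: nat \<Rightarrow> _. (\<forall>n. openin (subtopology (subtopology X A) D) (U n) \<and> U n \<noteq> {}) \<and>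
      (\<forall>V. openin (subtopology X A) V \<and> x \<in> V \<longrightarrow> (\<forall>\<^sub>F n in sequentially. U n \<subseteq> V))"
    using U(1,2) DA by (intro exI[of _ U]) (simp add: subtopology_subtopology)
qed

text \<open>
  All relatively open sets of continuity in \<open>A\<close> are pasted together. If their union were not dense,
  the hypothesis applied to the complement of its closure would give one more such set.
\<close>

lemma weakly_discontinuous_mapI:
  assumes local: "\<And>A. A \<subseteq> topspace X \<Longrightarrow> A \<noteq> {} \<Longrightarrow>
      \<exists>U. openin (subtopology X A) U \<and> U \<noteq> {} \<and> continuous_map (subtopology X U) Y f"
  shows "weakly_discontinuous_map X Y f"
  unfolding weakly_discontinuous_map_def
proof (intro allI impI)
  fix A assume A: "A \<subseteq> topspace X"
  define \<U> where "\<U> = {U. openin (subtopology X A) U \<and> continuous_map (subtopology X U) Y f}"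
  have op: "openin (subtopology X A) (\<Union>\<U>)" by (auto simp: \<U>_def)
  have "dense_in (subtopology X A) (\<Union>\<U>)"
  proof -
    define D where "D = A - (subtopology X A) closure_of (\<Union>\<U>)"
    have D: "openin (subtopology X A) D"
      using A openin_diff[OF openin_topspace closedin_closure_of, of "subtopology X A" "\<Union>\<U>"]
      by (simp add: D_def Int_absorb1)
    have "D = {}"
    proof (rule ccontr)
      assume "D \<noteq> {}"
      then obtain U where U: "openin (subtopology X D) U" "U \<noteq> {}" "continuous_map (subtopology X U) Y f"
        using local[of D] A by (auto simp: D_def)
      have "D \<subseteq> A" by (auto simp: D_def)
      then have "openin (subtopology X A) U"
        using U(1) D openin_trans_full[of "subtopology X A" D U]
        by (simp add: subtopology_subtopology Int_absorb1)
      then have "U \<in> \<U>" using U by (simp add: \<U>_def)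
      moreover have "U \<subseteq> D" using U(1) openin_subset by fastforce
      ultimately show False using U(2) closure_of_subset[OF openin_subset[OF op]]
        unfolding D_def by blast
    qed
    then show ?thesis using A openin_subset[OF op] closure_of_subset_topspace[of "subtopology X A" "\<Union>\<U>"]
      by (auto simp: dense_in_def D_def)
  qed
  moreover have "continuous_map (subtopology X (\<Union>\<U>)) Y f"
  proof (rule pasting_lemma[where I = \<U> and T = "\<lambda>U. U" and f = "\<lambda>_. f"])
    fix U assume U: "U \<in> \<U>"
    then obtain V where V: "openin X V" "U = V \<inter> A"
      by (auto simp: \<U>_def openin_subtopology)
    have "\<Union>\<U> \<subseteq> A" using openin_subset[OF op] by auto
    then have "U = V \<inter> \<Union>\<U>" using U V by blast
    then show "openin (subtopology X (\<Union>\<U>)) U"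
      using V by (auto simp: openin_subtopology)
    have "\<Union>\<U> \<inter> U = U" using U by blast
    then show "continuous_map (subtopology (subtopology X (\<Union>\<U>)) U) Y f"
      using U by (simp add: \<U>_def subtopology_subtopology)
  qed auto
  ultimately show "\<exists>U. openin (subtopology X A) U \<and> dense_in (subtopology X A) U \<and>
      continuous_map (subtopology X U) Y f"
    using op by blast
qed

text \<open>
  The homogeneous part is sought in \<open>f ` U\<close> instead of \<open>S\<close>, where \<open>U\<close> is an open set of
  continuity in \<open>S\<close>.
\<close>

lemma weakly_discontinuous_imp_resolvable_map:
  assumes f: "f \<in> topspace X \<rightarrow> topspace Y" and wd: "weakly_discontinuous_map X Y f"
  shows "resolvable_map X Y f"
  unfolding resolvable_map_def
proof (intro allI impI)
  fix R assume R: "resolvable_in Y R"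
  let ?A = "{x \<in> topspace X. f x \<in> R}"
  have "\<exists>V. openin X V \<and> V \<inter> S \<noteq> {} \<and> (V \<inter> S \<subseteq> ?A \<or> V \<inter> S \<inter> ?A = {})"
    if S: "S \<subseteq> topspace X" "S \<noteq> {}" for S
  proof -
    obtain U where U: "openin (subtopology X S) U" "dense_in (subtopology X S) U"
        "continuous_map (subtopology X U) Y f"
      using wd S(1) unfolding weakly_discontinuous_map_def by blast
    have US: "U \<subseteq> S" "U \<subseteq> topspace X" using U(1) openin_subset by fastforce+
    have "U \<noteq> {}" using U(2) S by (auto simp: dense_in_def)
    moreover have "f ` U \<subseteq> topspace Y" using f US by blast
    ultimately obtain W where W: "openin Y W" "W \<inter> f ` U \<noteq> {}"
        "W \<inter> f ` U \<subseteq> R \<or> W \<inter> f ` U \<inter> R = {}"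
      using resolvable_in_homogeneous_part[OF R, of "f ` U"] by (metis image_is_empty)
    have "openin (subtopology X U) {x \<in> topspace (subtopology X U). f x \<in> W}"
      using U(3) W(1) by (rule openin_continuous_map_preimage)
    then have "openin (subtopology X U) {x \<in> U. f x \<in> W}"
      using US by (simp add: Int_absorb1)
    then have "openin (subtopology X S) {x \<in> U. f x \<in> W}"
      using U(1) US openin_trans_full[of "subtopology X S" U]
      by (simp add: subtopology_subtopology Int_absorb1)
    then obtain V where V: "openin X V" "{x \<in> U. f x \<in> W} = V \<inter> S"
      by (auto simp: openin_subtopology)
    then show ?thesis
      using W(2,3) by (intro exI[of _ V]) (use US in blast)
  qed
  then show "resolvable_in X ?A" unfolding resolvable_in_iff by auto
qed

section \<open>Bookkeeping for recursive constructions\<close>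

text \<open>
  The point with index \<open>j > 0\<close> is to be chosen in a member of the sequence converging to the point
  \<open>parent j\<close>, at a position at least \<open>threshold j\<close>. Halving \<open>j - 1\<close> before decoding the pair makes
  every combination occur for an even and for an odd \<open>j\<close>.
\<close>

definition parent :: "nat \<Rightarrow> nat" where
  "parent j = fst (prod_decode ((j - 1) div 2))"

definition threshold :: "nat \<Rightarrow> nat" where
  "threshold j = snd (prod_decode ((j - 1) div 2))"

lemma parent_less: "0 < j \<Longrightarrow> parent j < j"
  using le_prod_encode_1[of "parent j" "threshold j"] by (simp add: parent_def threshold_def)

lemma children_of_both_parities:
  obtains j where "0 < j" "parent j = i" "threshold j = n" "even j \<longleftrightarrow> e"
proof
  let ?j = "2 * prod_encode (i, n) + (if e then 2 else 1)"
  show "0 < ?j" "parent ?j = i" "threshold ?j = n" "even ?j \<longleftrightarrow> e"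
    by (simp_all add: parent_def threshold_def)
qed

text \<open>
  A form of dependent choice in which the next element may depend on all the earlier ones.
\<close>

lemma dependent_choice_history:
  assumes "P []" and step: "\<And>xs. P xs \<Longrightarrow> \<exists>x. P (xs @ [x])"
  shows "\<exists>s. \<forall>n. P (map s [0..<n])"
proof -
  have "\<exists>h. \<forall>n. (P (h n) \<and> length (h n) = n) \<and> (\<exists>x. h (Suc n) = h n @ [x])"
    using assms by (intro dependent_nat_choice) fastforce+
  then obtain h where h: "\<And>n. P (h n)" "\<And>n. length (h n) = n"
      "\<And>n. \<exists>x. h (Suc n) = h n @ [x]" by blast
  have "h n = map (\<lambda>i. last (h (Suc i))) [0..<n]" for n
  proof (induction n)
    case 0
    then show ?case using h(2)[of 0] by simp
  next
    case (Suc n)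
    then show ?case using h(3)[of n] by auto
  qed
  then show ?thesis using h(1) by metis
qed

text \<open>
  One step of the construction: the point \<open>x\<^sub>j\<close>, the neighbourhood \<open>B\<^sub>j\<close> of its image, and a
  sequence of open sets converging to \<open>x\<^sub>j\<close>, the targets for later points.
\<close>

datatype ('a, 'b) stage = Stage (point: 'a) (nbhd: "'b set") (target: "nat \<Rightarrow> 'a set")

section \<open>Escaping points\<close>

locale base_resolvable_setting =
  fixes X :: "'a topology" and Y :: "'b topology" and f :: "'a \<Rightarrow> 'b" and \<B> :: "'b set set"
  assumes f_into: "f \<in> topspace X \<rightarrow> topspace Y"
    and regular: "regular_space Y"
    and base: "topology_base Y \<B>"
    and resolvable: "B \<in> \<B> \<Longrightarrow> resolvable_in X {x \<in> topspace X. f x \<in> B}"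
begin

definition avoiding :: "'b set \<Rightarrow> 'a set" where
  "avoiding V = X interior_of {x \<in> topspace X. f x \<notin> V}"

lemma openin_avoiding [simp]: "openin X (avoiding V)"
  by (simp add: avoiding_def)

lemma avoidingD: "x \<in> avoiding V \<Longrightarrow> x \<in> topspace X \<and> f x \<notin> V"
  unfolding avoiding_def using interior_of_subset by fastforce

lemma avoidingI: "openin X H \<Longrightarrow> f ` H \<inter> V = {} \<Longrightarrow> H \<subseteq> avoiding V"
  unfolding avoiding_def
  by (rule interior_of_maximal) (use openin_subset in blast)+

lemma avoiding_antimono: "V \<subseteq> W \<Longrightarrow> avoiding W \<subseteq> avoiding V"
  using avoidingI[OF openin_avoiding, of W V] avoidingD by blast

lemma avoiding_Un: "avoiding (V \<union> W) = avoiding V \<inter> avoiding W"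
proof
  show "avoiding V \<inter> avoiding W \<subseteq> avoiding (V \<union> W)"
  proof (rule avoidingI)
    show "openin X (avoiding V \<inter> avoiding W)" by (simp add: openin_Int)
    show "f ` (avoiding V \<inter> avoiding W) \<inter> (V \<union> W) = {}"
      by (auto dest: avoidingD)
  qed
qed (use avoiding_antimono in blast)

lemma avoiding_empty [simp]: "avoiding {} = topspace X"
  by (simp add: avoiding_def)

text \<open>
  Open sets that $f$ keeps away from \<open>f x\<close> accumulate at an escaping point \<open>x\<close>. This is stronger than
  discontinuity, which yields only points with images away from \<open>f x\<close>; open sets are needed because
  the construction continues inside them.
\<close>

definition escaping :: "'a \<Rightarrow> bool" where
  "escaping x \<longleftrightarrow> (\<exists>P. openin Y P \<and> f x \<in> P \<and> x \<in> X closure_of avoiding P)"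

lemma base_open: "B \<in> \<B> \<Longrightarrow> openin Y B"
  using base by (simp add: topology_base_def)

lemma base_shrink:
  assumes "openin Y P" "y \<in> P"
  obtains B C where "B \<in> \<B>" "closedin Y C" "y \<in> B" "B \<subseteq> C" "C \<subseteq> P"
proof -
  obtain U C where UC: "openin Y U" "closedin Y C" "y \<in> U" "U \<subseteq> C" "C \<subseteq> P"
    using regular assms unfolding neighbourhood_base_of_closedin[symmetric] neighbourhood_base_of
    by metis
  moreover obtain B where "B \<in> \<B>" "y \<in> B" "B \<subseteq> U"
    using base UC(1,3) unfolding topology_base_def by blast
  ultimately show thesis using that by blast
qed

lemma open_avoids_or_maps_into_base:
  assumes B: "B \<in> \<B>" and H: "openin X H" "H \<noteq> {}" "H \<inter> avoiding B = {}"
  obtains K where "openin X K" "K \<noteq> {}" "K \<subseteq> H" "f ` K \<subseteq> B"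
proof -
  let ?A = "{x \<in> topspace X. f x \<in> B}"
  obtain V where V: "openin X V" "V \<inter> H \<noteq> {}" "V \<inter> H \<subseteq> ?A \<or> V \<inter> H \<inter> ?A = {}"
    using resolvable_in_homogeneous_part[OF resolvable[OF B] openin_subset[OF H(1)] H(2)] .
  have VH: "openin X (V \<inter> H)" using V H by blast
  have "\<not> V \<inter> H \<inter> ?A = {}"
  proof
    assume "V \<inter> H \<inter> ?A = {}"
    then have "V \<inter> H \<subseteq> avoiding B"
      using openin_subset[OF VH] by (intro avoidingI[OF VH]) blast
    then show False using V H by blast
  qed
  then show thesis using that[OF VH] V by blast
qed

text \<open>
  Let \<open>x \<in> W\<close>, and let \<open>B \<subseteq> C \<subseteq> P\<close> be neighbourhoods of \<open>f x\<close> with \<open>C\<close> closed. As \<open>x\<close> is not escaping,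
  the open sets mapped into \<open>B\<close> are dense in some neighbourhood \<open>V\<close> of \<open>x\<close>. If a point \<open>z \<in> V\<close>
  had its image outside \<open>P\<close>, hence outside \<open>C\<close>, then likewise the sets mapped into \<open>B\<close> could not
  accumulate at \<open>z\<close>, since \<open>z\<close> is not escaping either.
\<close>

lemma continuous_if_no_escaping:
  assumes W: "openin X W" and none: "\<And>x. x \<in> W \<Longrightarrow> \<not> escaping x"
  shows "continuous_map (subtopology X W) Y f"
proof -
  have "\<exists>V. openin X V \<and> x \<in> V \<and> V \<subseteq> W \<and> f ` V \<subseteq> P"
    if x: "x \<in> W" and P: "openin Y P" "f x \<in> P" for x P
  proof -
    obtain B C where BC: "B \<in> \<B>" "closedin Y C" "f x \<in> B" "B \<subseteq> C" "C \<subseteq> P"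
      using base_shrink[OF P] .
    have "x \<notin> X closure_of avoiding B"
      using none[OF x] BC base_open unfolding escaping_def by blast
    define V where "V = W - X closure_of avoiding B"
    have V: "openin X V" using W by (auto simp: V_def)
    have VB: "V \<inter> avoiding B = {}"
      using closure_of_subset[OF openin_subset[OF openin_avoiding]] by (auto simp: V_def)
    have "f z \<in> P" if z: "z \<in> V" for z
    proof (rule ccontr)
      assume "f z \<notin> P"
      then have fz: "f z \<in> topspace Y - C"
        using f_into z openin_subset[OF V] BC by blast
      have "openin Y (topspace Y - C)" using BC by blast
      then have "z \<notin> X closure_of avoiding (topspace Y - C)"
        using none[of z] fz z unfolding escaping_def V_def by blast
      then obtain N where N: "openin X N" "z \<in> N" "N \<inter> avoiding (topspace Y - C) = {}"
        using z openin_subset[OF V] unfolding in_closure_of by blast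
      obtain K where K: "openin X K" "K \<noteq> {}" "K \<subseteq> N \<inter> V" "f ` K \<subseteq> B"
        using open_avoids_or_maps_into_base[OF BC(1), of "N \<inter> V"] N V z VB by blast
      have "K \<subseteq> avoiding (topspace Y - C)" using K BC by (intro avoidingI) blast+
      then show False using K N by blast
    qed
    then show ?thesis using V x \<open>x \<notin> X closure_of avoiding B\<close>
      by (intro exI[of _ V]) (auto simp: V_def)
  qed
  note nbhd = this
  have "openin X {x \<in> W. f x \<in> P}" if P: "openin Y P" for P
  proof (subst openin_subopen, intro ballI)
    fix x assume "x \<in> {x \<in> W. f x \<in> P}"
    then obtain V where "openin X V" "x \<in> V" "V \<subseteq> W" "f ` V \<subseteq> P"
      using nbhd[of x P] P by blast
    then show "\<exists>T. openin X T \<and> x \<in> T \<and> T \<subseteq> {x \<in> W. f x \<in> P}"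
      by (intro exI[of _ V]) blast
  qed
  then show ?thesis
    using f_into W openin_subset[OF W]
    by (auto simp: continuous_map Int_absorb1 openin_open_subtopology)
qed

text \<open>
  Once an escaping point \<open>x\<close> with a neighbourhood \<open>B\<close> of \<open>f x\<close> is found, the remaining points are
  sought in an open set mapped off a closed set \<open>K\<close> that contains \<open>B\<close>. Then their neighbourhoods can be
  taken in the complement of \<open>K\<close>, which is what \<open>Q\<close> records during the induction.
\<close>

lemma disjoint_escaping_points:
  assumes dense: "\<forall>H. openin X H \<and> H \<noteq> {} \<longrightarrow> (\<exists>x\<in>H. escaping x)"
    and "openin X H" "H \<noteq> {}" "openin Y Q" "f ` H \<subseteq> Q"
  shows "\<exists>C. finite C \<and> card C = n \<and> pairwise (\<lambda>p q. disjnt (snd p) (snd q)) C \<and>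
    (\<forall>(x, B)\<in>C. x \<in> H \<and> B \<in> \<B> \<and> f x \<in> B \<and> B \<subseteq> Q \<and> x \<in> X closure_of avoiding B)"
  using assms(2-)
proof (induction n arbitrary: H Q)
  case 0
  then show ?case by (intro exI[of _ "{}"]) auto
next
  case (Suc n)
  obtain x P where x: "x \<in> H" and P: "openin Y P" "f x \<in> P" "x \<in> X closure_of avoiding P"
    using dense[rule_format, OF conjI[OF Suc.prems(1,2)]] by (auto simp: escaping_def)
  have "openin Y (P \<inter> Q)" "f x \<in> P \<inter> Q" using P x Suc.prems by blast+
  then obtain B K where BK: "B \<in> \<B>" "closedin Y K" "f x \<in> B" "B \<subseteq> K" "K \<subseteq> P \<inter> Q"
    by (rule base_shrink)
  define H' where "H' = H \<inter> avoiding P"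
  define Q' where "Q' = Q \<inter> (topspace Y - K)"
  have "H' \<noteq> {}"
    using open_meets_if_meets_closure[OF P(3) Suc.prems(1) x] by (simp add: H'_def)
  moreover have "f ` H' \<subseteq> Q'"
    using Suc.prems BK f_into avoidingD[of _ P] unfolding H'_def Q'_def by blast
  moreover have "openin X H'" "openin Y Q'"
    using Suc.prems BK by (simp_all add: H'_def Q'_def openin_Int openin_diff)
  ultimately obtain C where C: "finite C" "card C = n" "pairwise (\<lambda>p q. disjnt (snd p) (snd q)) C"
     "\<forall>(x, B)\<in>C. x \<in> H' \<and> B \<in> \<B> \<and> f x \<in> B \<and> B \<subseteq> Q' \<and> x \<in> X closure_of avoiding B"
    using Suc.IH by blast
  have disj: "disjnt B (snd p)" "disjnt (snd p) B" if "p \<in> C" for p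
    using C(4) that BK unfolding Q'_def disjnt_def by fastforce+
  have "(x, B) \<notin> C" using disj BK by (force simp: disjnt_def)
  moreover have "x \<in> X closure_of avoiding B"
    using P(3) BK closure_of_mono[OF avoiding_antimono[of B P]] by blast
  ultimately show ?case
    using C disj x BK
    by (intro exI[of _ "insert (x, B) C"])
       (auto simp: pairwise_insert H'_def Q'_def)
qed

section \<open>Alternating dense sequences\<close>

definition used :: "('a, 'b) stage list \<Rightarrow> 'b set" where
  "used xs = (\<Union>s\<in>set xs. nbhd s)"

definition good_stage :: "('a, 'b) stage \<Rightarrow> bool" where
  "good_stage s \<longleftrightarrow> point s \<in> topspace X \<and> nbhd s \<in> \<B> \<and> f (point s) \<in> nbhd s \<and>
     (\<forall>n. openin X (target s n)) \<and>
     (\<forall>V. openin X V \<and> point s \<in> V \<longrightarrow> (\<forall>\<^sub>F n in sequentially. target s n \<subseteq> V))"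

text \<open>
  The condition on \<open>avoiding (used xs)\<close> keeps the construction alive: infinitely many targets of each
  point retain an open part whose points are still eligible.
\<close>

definition admissible :: "('a, 'b) stage list \<Rightarrow> bool" where
  "admissible xs \<longleftrightarrow>
     (\<forall>s\<in>set xs. good_stage s \<and>
        (\<exists>\<^sub>F n in sequentially. target s n \<inter> avoiding (used xs) \<noteq> {})) \<and>
     (\<forall>i<length xs. \<forall>j<length xs. i \<noteq> j \<longrightarrow> f (point (xs ! i)) \<notin> nbhd (xs ! j)) \<and>
     (\<forall>j<length xs. 0 < j \<longrightarrow>
        (\<exists>m\<ge>threshold j. point (xs ! j) \<in> target (xs ! parent j) m))"

text \<open>
  If no open part of a target that meets \<open>G\<close> is contained in \<open>G\<close> and mapped off \<open>B\<close>, then some open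
  part of it within \<open>G\<close> is mapped into \<open>B\<close>, and thus off \<open>B'\<close>.
\<close>

lemma at_most_one_disjoint_nbhd_obstructs:
  assumes target: "\<And>n. openin X (target s n)"
    and G: "openin X G" "\<exists>\<^sub>F n in sequentially. target s n \<inter> G \<noteq> {}"
    and B: "B \<in> \<B>" "disjnt B B'"
    and obs: "\<not> (\<exists>\<^sub>F n in sequentially. target s n \<inter> (G \<inter> avoiding B) \<noteq> {})"
      "\<not> (\<exists>\<^sub>F n in sequentially. target s n \<inter> (G \<inter> avoiding B') \<noteq> {})"
  shows False
proof -
  have "\<forall>\<^sub>F n in sequentially. target s n \<inter> (G \<inter> avoiding B) = {} \<and>
      target s n \<inter> (G \<inter> avoiding B') = {}"
    using obs by (simp add: not_frequently eventually_conj_iff)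
  from frequently_ex[OF frequently_eventually_frequently[OF G(2) this]] obtain n
    where n: "target s n \<inter> G \<noteq> {}" "target s n \<inter> (G \<inter> avoiding B) = {}"
      "target s n \<inter> (G \<inter> avoiding B') = {}"
    by (elim exE conjE)
  have "openin X (target s n \<inter> G)" using target G(1) by blast
  then obtain K where K: "openin X K" "K \<noteq> {}" "K \<subseteq> target s n \<inter> G" "f ` K \<subseteq> B"
    using open_avoids_or_maps_into_base[OF B(1), of "target s n \<inter> G"] n by blast
  have "K \<subseteq> avoiding B'" using K B(2) by (intro avoidingI) (auto simp: disjnt_def)
  then show False using K n by blast
qed

text \<open>
  The candidates are chosen in \<open>H\<close>, which is mapped off the old neighbourhoods. A candidate is bad for
  an old point if its neighbourhood contains the image of that point (\<open>hit\<close>) or uses up almost all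
  targets of that point (\<open>obstructed\<close>). Each old point accounts for at most two bad candidates. The
  targets of the new point exist because it is escaping and lies in the open set \<open>G\<close>.
\<close>

lemma admissible_extend:
  assumes ps: "Preiss_Simon_space X" and ne: "topspace X \<noteq> {}"
    and dense: "\<forall>H. openin X H \<and> H \<noteq> {} \<longrightarrow> (\<exists>x\<in>H. escaping x)"
    and adm: "admissible xs"
  shows "\<exists>s. admissible (xs @ [s])"
proof -
  define N where "N = length xs"
  define G where "G = avoiding (used xs)"
  have good: "good_stage s" "\<exists>\<^sub>F n in sequentially. target s n \<inter> G \<noteq> {}"
    if "s \<in> set xs" for s
    using adm that by (auto simp: admissible_def G_def)
  have "\<exists>H. openin X H \<and> H \<noteq> {} \<and> H \<subseteq> G \<and>
      (0 < N \<longrightarrow> (\<exists>m\<ge>threshold N. H \<subseteq> target (xs ! parent N) m))"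
  proof (cases "N = 0")
    case True
    then show ?thesis using ne by (auto simp: N_def G_def used_def)
  next
    case False
    then have p: "xs ! parent N \<in> set xs" using parent_less by (simp add: N_def)
    obtain m where m: "m \<ge> threshold N" "target (xs ! parent N) m \<inter> G \<noteq> {}"
      using good(2)[OF p] unfolding frequently_sequentially by blast
    have "openin X (target (xs ! parent N) m \<inter> G)"
      using good(1)[OF p] by (simp add: good_stage_def G_def openin_Int)
    then show ?thesis using m by blast
  qed
  then obtain H where H: "openin X H" "H \<noteq> {}" "H \<subseteq> G"
      and H_target: "0 < N \<Longrightarrow> \<exists>m\<ge>threshold N. H \<subseteq> target (xs ! parent N) m" by blast
  have "f ` H \<subseteq> topspace Y" using f_into openin_subset[OF H(1)] by blast
  from disjoint_escaping_points[OF dense H(1,2) openin_topspace this, of "2 * N + 1"]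
  obtain C where C: "finite C" "card C = 2 * N + 1"
      and disj: "pairwise (\<lambda>p q. disjnt (snd p) (snd q)) C"
      and C_cand: "\<forall>(x, B)\<in>C. x \<in> H \<and> B \<in> \<B> \<and> f x \<in> B \<and> B \<subseteq> topspace Y \<and> x \<in> X closure_of avoiding B"
    by (elim exE conjE)
  have cand: "x \<in> H \<and> B \<in> \<B> \<and> f x \<in> B \<and> x \<in> X closure_of avoiding B"
    if "(x, B) \<in> C" for x B
    using bspec[OF C_cand that] by simp
  define hit where "hit i = {c \<in> C. f (point (xs ! i)) \<in> snd c}" for i
  define obstructed where "obstructed i = {c \<in> C. \<not> (\<exists>\<^sub>F n in sequentially.
      target (xs ! i) n \<inter> (G \<inter> avoiding (snd c)) \<noteq> {})}" for i
  have "card (hit i) \<le> 1" for i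
  proof -
    have "c = d" if c: "c \<in> hit i" and d: "d \<in> hit i" for c d
    proof (rule ccontr)
      assume "c \<noteq> d"
      then have "disjnt (snd c) (snd d)" using c d pairwiseD[OF disj, of c d] by (simp add: hit_def)
      then show False using c d by (auto simp: hit_def disjnt_def)
    qed
    then show ?thesis using C(1) by (simp add: card_le_Suc0_iff_eq hit_def)
  qed
  moreover have "card (obstructed i) \<le> 1" if "i < N" for i
  proof -
    have s: "xs ! i \<in> set xs" using that by (simp add: N_def)
    have "c = d" if "c \<in> obstructed i" "d \<in> obstructed i" for c d
    proof (rule ccontr)
      assume "c \<noteq> d"
      then have "disjnt (snd c) (snd d)" "snd c \<in> \<B>"
        using that pairwiseD[OF disj, of c d] cand[of "fst c" "snd c"]
        by (simp_all add: obstructed_def)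
      moreover have "openin X (target (xs ! i) n)" for n
        using good(1)[OF s] by (simp add: good_stage_def)
      moreover have "openin X G" by (simp add: G_def)
      ultimately show False
        using at_most_one_disjoint_nbhd_obstructs[OF _ _ good(2)[OF s], of "snd c" "snd d"] that
        unfolding obstructed_def by blast
    qed
    then show ?thesis using C(1) by (simp add: card_le_Suc0_iff_eq obstructed_def)
  qed
  ultimately have "card (hit i \<union> obstructed i) \<le> 2" if "i < N" for i
    using card_Un_le[of "hit i" "obstructed i"] that by (metis add_mono le_trans one_add_one)
  then have "card (\<Union>i<N. hit i \<union> obstructed i) \<le> 2 * N"
    using card_UN_le[of "{..<N}" "\<lambda>i. hit i \<union> obstructed i"]
      sum_bounded_above[of "{..<N}" "\<lambda>i. card (hit i \<union> obstructed i)" 2] by simp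
  then have "\<not> C \<subseteq> (\<Union>i<N. hit i \<union> obstructed i)"
    using C card_mono[of "\<Union>i<N. hit i \<union> obstructed i" C]
    by (force simp: hit_def obstructed_def)
  then obtain x B where c: "(x, B) \<in> C" "\<And>i. i < N \<Longrightarrow> (x, B) \<notin> hit i \<union> obstructed i"
    by auto
  have x: "x \<in> H" "B \<in> \<B>" "f x \<in> B" "x \<in> X closure_of avoiding B" using cand[OF c(1)] by auto
  have xG: "x \<in> topspace X" "f x \<notin> used xs"
    using x(1) H(3) avoidingD unfolding G_def by blast+
  have "x \<in> X closure_of (G \<inter> avoiding B)"
    using openin_Int_closure_of_subset[of X G "avoiding B"] x H(3) by (auto simp: G_def)
  moreover have GB: "openin X (G \<inter> avoiding B)" by (simp add: G_def openin_Int)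
  ultimately obtain U :: "nat \<Rightarrow> 'a set"
    where "\<And>n. openin (subtopology X (G \<inter> avoiding B)) (U n)" "\<And>n. U n \<noteq> {}"
      and U_lim: "\<And>V. openin X V \<Longrightarrow> x \<in> V \<Longrightarrow> \<forall>\<^sub>F n in sequentially. U n \<subseteq> V"
    using Preiss_Simon_sequence[OF ps openin_subset[OF GB]] by metis
  then have U: "openin X (U n)" "U n \<subseteq> G \<inter> avoiding B" "U n \<noteq> {}" for n
    using openin_open_subtopology[OF GB] by simp_all
  define s where "s = Stage x B U"
  have used: "avoiding (used (xs @ [s])) = G \<inter> avoiding B"
    by (simp add: used_def G_def s_def avoiding_Un Un_commute Int_commute)
  have "good_stage s" using xG x U U_lim by (simp add: good_stage_def s_def)
  moreover have "\<exists>\<^sub>F n in sequentially. target s n \<inter> (G \<inter> avoiding B) \<noteq> {}"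
    using U(2,3) by (simp add: s_def Int_absorb2)
  moreover have "\<exists>\<^sub>F n in sequentially. target t n \<inter> (G \<inter> avoiding B) \<noteq> {}" if "t \<in> set xs" for t
    using c that by (fastforce simp: obstructed_def in_set_conv_nth N_def)
  moreover have "f x \<notin> nbhd (xs ! i)" "f (point (xs ! i)) \<notin> B" if "i < N" for i
    using xG(2) c(1) c(2)[OF that] that by (auto simp: used_def hit_def N_def)
  moreover have "\<exists>m\<ge>threshold N. x \<in> target (xs ! parent N) m" if "0 < N"
    using H_target[OF that] x(1) by blast
  moreover have "parent j < length xs" if "0 < j" "j < Suc (length xs)" for j
    using parent_less[OF that(1)] that(2) by simp
  ultimately have "admissible (xs @ [s])"
    using adm good(1) unfolding admissible_def used
    by (auto simp: nth_append less_Suc_eq N_def s_def)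
  then show ?thesis by blast
qed

text \<open>
  If escaping points were dense, the construction would never stop. In the set \<open>?Q\<close> of the resulting
  points, an open set around any of them contains points of both parities.
\<close>

lemma escaping_not_dense:
  assumes ps: "Preiss_Simon_space X" and ne: "topspace X \<noteq> {}" and ca: "countably_additive \<B>"
  shows "\<exists>H. openin X H \<and> H \<noteq> {} \<and> (\<forall>x\<in>H. \<not> escaping x)"
proof (rule ccontr)
  assume "\<not> ?thesis"
  then have dense: "\<forall>H. openin X H \<and> H \<noteq> {} \<longrightarrow> (\<exists>x\<in>H. escaping x)" by blast
  have "admissible []" by (simp add: admissible_def)
  then obtain s where s: "\<And>n. admissible (map s [0..<n])"
    using dependent_choice_history[of admissible] admissible_extend[OF ps ne dense] by metis
  have good: "good_stage (s i)" for i using s[of "Suc i"] by (simp add: admissible_def)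
  have sep: "f (point (s i)) \<in> nbhd (s j) \<longleftrightarrow> i = j" for i j
  proof (cases "i = j")
    case True
    then show ?thesis using good by (simp add: good_stage_def)
  next
    case False
    then show ?thesis using s[of "Suc (max i j)"] unfolding admissible_def
      by (auto simp del: upt_Suc)
  qed
  have child: "\<exists>m\<ge>threshold j. point (s j) \<in> target (s (parent j)) m" if "0 < j" for j
    using s[of "Suc j", unfolded admissible_def, THEN conjunct2, THEN conjunct2, rule_format, of j]
      that parent_less[OF that]
    by (simp del: upt_Suc)
  define B where "B = (\<Union>j\<in>{j. even j}. nbhd (s j))"
  have "(\<lambda>j. nbhd (s j)) ` {j. even j} \<subseteq> \<B>" using good by (auto simp: good_stage_def)
  then have "B \<in> \<B>"
    using ca unfolding countably_additive_def B_def by simp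
  let ?Q = "range (\<lambda>j. point (s j))"
  have Q: "?Q \<subseteq> topspace X" "?Q \<noteq> {}" using good by (auto simp: good_stage_def)
  obtain V where V: "openin X V" "V \<inter> ?Q \<noteq> {}"
      "V \<inter> ?Q \<subseteq> {x \<in> topspace X. f x \<in> B} \<or> V \<inter> ?Q \<inter> {x \<in> topspace X. f x \<in> B} = {}"
    using resolvable_in_homogeneous_part[OF resolvable[OF \<open>B \<in> \<B>\<close>] Q] .
  obtain i where i: "point (s i) \<in> V" using V(2) by blast
  then have "\<forall>\<^sub>F n in sequentially. target (s i) n \<subseteq> V"
    using good[of i] V(1) by (simp add: good_stage_def)
  then obtain n where n: "\<forall>m\<ge>n. target (s i) m \<subseteq> V"
    unfolding eventually_sequentially by (elim exE)
  have "\<exists>j. point (s j) \<in> V \<and> (even j \<longleftrightarrow> e)" for e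
  proof -
    obtain j where j: "0 < j" "parent j = i" "threshold j = n" "even j \<longleftrightarrow> e"
      by (rule children_of_both_parities)
    then obtain m where "n \<le> m" "point (s j) \<in> target (s i) m" using child[OF j(1)] by auto
    then show ?thesis using n j(4) by blast
  qed
  from this[of True] this[of False]
  obtain j k where "point (s j) \<in> V" "even j" "point (s k) \<in> V" "odd k" by auto
  moreover have "f (point (s j)) \<in> B \<longleftrightarrow> even j" for j using sep by (auto simp: B_def)
  ultimately show False using V(3) Q(1) by blast
qed

end

section \<open>The equivalence\<close>

lemma base_resolvable_imp_weakly_discontinuous:
  assumes f: "f \<in> topspace X \<rightarrow> topspace Y" and ps: "Preiss_Simon_space X"
    and reg: "regular_space Y" and br: "base_resolvable_map X Y f"
  shows "weakly_discontinuous_map X Y f"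
proof (rule weakly_discontinuous_mapI)
  fix A assume A: "A \<subseteq> topspace X" "A \<noteq> {}"
  obtain \<B> where \<B>: "topology_base Y \<B>" "countably_additive \<B>"
      "\<And>B. B \<in> \<B> \<Longrightarrow> resolvable_in X {x \<in> topspace X. f x \<in> B}"
    using br by (auto simp: base_resolvable_map_def)
  have "resolvable_in (subtopology X A) {x \<in> topspace (subtopology X A). f x \<in> B}" if "B \<in> \<B>" for B
  proof -
    have "{x \<in> topspace (subtopology X A). f x \<in> B} = {x \<in> topspace X. f x \<in> B} \<inter> A" by auto
    then show ?thesis using resolvable_in_subspace[OF \<B>(3)[OF that], of A] by simp
  qed
  then interpret base_resolvable_setting "subtopology X A" Y f \<B>
    using f reg \<B> by unfold_locales auto
  obtain H where H: "openin (subtopology X A) H" "H \<noteq> {}" "\<And>x. x \<in> H \<Longrightarrow> \<not> escaping x"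
    using escaping_not_dense[OF Preiss_Simon_subspace[OF ps] _ \<B>(2)] A
    by (auto simp: Int_absorb1)
  have "A \<inter> H = H" using openin_subset[OF H(1)] by auto
  then show "\<exists>U. openin (subtopology X A) U \<and> U \<noteq> {} \<and> continuous_map (subtopology X U) Y f"
    using H continuous_if_no_escaping[OF H(1,3)] by (auto simp: subtopology_subtopology)
qed

theorem theorem1p2:
  fixes X :: "'a topology" and Y :: "'b topology" and f :: "'a \<Rightarrow> 'b"
  assumes "f \<in> topspace X \<rightarrow> topspace Y"
    and "Preiss_Simon_space X"
    and "regular_space Y"
  shows "(weakly_discontinuous_map X Y f \<longleftrightarrow> resolvable_map X Y f) \<and>
         (resolvable_map X Y f \<longleftrightarrow> open_resolvable_map X Y f) \<and>
         (open_resolvable_map X Y f \<longleftrightarrow> base_resolvable_map X Y f)"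
proof -
  have "resolvable_map X Y f \<Longrightarrow> open_resolvable_map X Y f"
    by (simp add: resolvable_map_def open_resolvable_map_def open_imp_resolvable_in)
  moreover have "base_resolvable_map X Y f" if "open_resolvable_map X Y f"
    unfolding base_resolvable_map_def
  proof (intro exI[of _ "{U. openin Y U}"] conjI)
    show "topology_base Y {U. openin Y U}"
      unfolding topology_base_def by (auto intro!: exI[of _ "{_}"])
  qed (use that in \<open>auto simp: countably_additive_def open_resolvable_map_def\<close>)
  ultimately show ?thesis
    using weakly_discontinuous_imp_resolvable_map[OF assms(1)]
      base_resolvable_imp_weakly_discontinuous[OF assms] by blast
qed

end
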